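(* Let $\mathbf{X}\subset\mathbb{R}^n$ be a Borel set and let $\mu,\lambda\in M(\mathbf{X})_+$ be two finite Borel measures. Consider the optimization problem $$\mathbf{P}:\quad \rho=\sup_{\nu}\{\nu(\mathbf{X}):\ \nu\le\mu,\ \nu\ll\lambda,\ \nu\in M(\mathbf{X})_+\}=\sup_{\nu,\psi}\{\nu(\mathbf{X}):\ \nu+\psi=\mu,\ \nu\in C_\lambda,\ \psi\in M(\mathbf{X})_+\}.$$ Then $\mathbf{P}$ has a unique optimal solution $\nu^*\in M(\mathbf{X})_+$, and $(\nu^*,\mu-\nu^* )$ provides the Lebesgue decomposition of $\mu$ with respect to $\lambda$, i.e. $\nu^*\ll\lambda$ and $\mu-\nu^*\perp\lambda$ with $\mu-\nu^*\in M(\mathbf{X})_+$.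
   Context: $M(\mathbf{X})_+$ is the convex cone of finite positive Borel measures on $\mathbf{X}$. The notation $\nu\le\mu$ is understood setwise: $\nu(B)\le\mu(B)$ for all Borel sets $B$. $\nu\ll\lambda$ means that $\nu$ is absolutely continuous with respect to $\lambda$, and $\psi\perp\lambda$ means that $\psi$ is singular with respect to $\lambda$. $C_\lambda:=\{\nu\in M(\mathbf{X})_+:\nu\ll\lambda\}$. The Lebesgue decomposition of $\mu$ with respect to $\lambda$ is the unique pair $(\nu,\psi)\in M(\mathbf{X})_+^2$ with $\mu=\nu+\psi$, $\nu\ll\lambda$, $\psi\perp\lambda$. An optimal solution is a feasible point at which the supremum is attained. *)

theory Defs
  imports "HOL-Analysis.Analysis"
begin

text \<open>The cone \<open>M(X)\<^sub>+\<close>. For Borel \<open>X\<close>, the measurable sets of \<open>restrict_space borel X\<close> are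
  the Borel subsets of \<open>X\<close>; equality of \<open>sets\<close> forces \<open>space \<nu> = X\<close>.\<close>

definition fin_borel_measures :: "'a::topological_space set \<Rightarrow> 'a measure set" where
  "fin_borel_measures X = {\<nu>. sets \<nu> = sets (restrict_space borel X) \<and> finite_measure \<nu>}"

definition mutually_singular :: "'a measure \<Rightarrow> 'a measure \<Rightarrow> bool" where
  "mutually_singular \<psi> \<Lambda> \<longleftrightarrow>
     sets \<psi> = sets \<Lambda> \<and>
     (\<exists>A\<in>sets \<Lambda>. emeasure \<psi> A = 0 \<and> emeasure \<Lambda> (space \<Lambda> - A) = 0)"

text \<open>\<open>\<nu> + \<psi> = \<mu>\<close> for measures on the same \<open>\<sigma>\<close>-algebra; the library has no addition of measures.\<close>

definition is_measure_sum :: "'a measure \<Rightarrow> 'a measure \<Rightarrow> 'a measure \<Rightarrow> bool" where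
  "is_measure_sum \<mu> \<nu> \<psi> \<longleftrightarrow>
     sets \<nu> = sets \<mu> \<and> sets \<psi> = sets \<mu> \<and>
     (\<forall>B\<in>sets \<mu>. emeasure \<nu> B + emeasure \<psi> B = emeasure \<mu> B)"

text \<open>The cone \<open>C\<^sub>\<Lambda>\<close>. Note the order of arguments: \<open>absolutely_continuous \<Lambda> \<nu>\<close> means \<open>\<nu> \<lless> \<Lambda>\<close>.\<close>

definition ac_cone :: "'a::topological_space set \<Rightarrow> 'a measure \<Rightarrow> 'a measure set" where
  "ac_cone X \<Lambda> = {\<nu> \<in> fin_borel_measures X. absolutely_continuous \<Lambda> \<nu>}"

definition lebesgue_decomposition ::
    "'a::topological_space set \<Rightarrow> 'a measure \<Rightarrow> 'a measure \<Rightarrow> 'a measure \<Rightarrow> 'a measure \<Rightarrow> bool" where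
  "lebesgue_decomposition X \<mu> \<Lambda> \<nu> \<psi> \<longleftrightarrow>
     \<nu> \<in> fin_borel_measures X \<and> \<psi> \<in> fin_borel_measures X \<and>
     is_measure_sum \<mu> \<nu> \<psi> \<and> absolutely_continuous \<Lambda> \<nu> \<and> mutually_singular \<psi> \<Lambda>"

text \<open>Feasible sets of the two forms of the problem \<open>P\<close>.\<close>

definition feasible ::
    "'a::topological_space set \<Rightarrow> 'a measure \<Rightarrow> 'a measure \<Rightarrow> 'a measure set" where
  "feasible X \<mu> \<Lambda> =
     {\<nu> \<in> fin_borel_measures X.
        (\<forall>B\<in>sets \<mu>. emeasure \<nu> B \<le> emeasure \<mu> B) \<and> absolutely_continuous \<Lambda> \<nu>}"

definition feasible_pairs ::
    "'a::topological_space set \<Rightarrow> 'a measure \<Rightarrow> 'a measure \<Rightarrow> ('a measure \<times> 'a measure) set" where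
  "feasible_pairs X \<mu> \<Lambda> =
     {(\<nu>, \<psi>). is_measure_sum \<mu> \<nu> \<psi> \<and> \<nu> \<in> ac_cone X \<Lambda> \<and> \<psi> \<in> fin_borel_measures X}"

text \<open>The suprema are taken in \<^typ>\<open>ennreal\<close>, a complete lattice, so that they are meaningful
  without a separate boundedness argument.\<close>

definition optimal_value ::
    "'a::topological_space set \<Rightarrow> 'a measure \<Rightarrow> 'a measure \<Rightarrow> ennreal" where
  "optimal_value X \<mu> \<Lambda> = (SUP \<nu>\<in>feasible X \<mu> \<Lambda>. emeasure \<nu> X)"

definition optimal_value_pairs ::
    "'a::topological_space set \<Rightarrow> 'a measure \<Rightarrow> 'a measure \<Rightarrow> ennreal" where
  "optimal_value_pairs X \<mu> \<Lambda> = (SUP (\<nu>, \<psi>)\<in>feasible_pairs X \<mu> \<Lambda>. emeasure \<nu> X)"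

definition optimal_solution ::
    "'a::topological_space set \<Rightarrow> 'a measure \<Rightarrow> 'a measure \<Rightarrow> 'a measure \<Rightarrow> bool" where
  "optimal_solution X \<mu> \<Lambda> \<nu> \<longleftrightarrow>
     \<nu> \<in> feasible X \<mu> \<Lambda> \<and> emeasure \<nu> X = optimal_value X \<mu> \<Lambda>"

definition optimal_solution_pair ::
    "'a::topological_space set \<Rightarrow> 'a measure \<Rightarrow> 'a measure \<Rightarrow> 'a measure \<Rightarrow> 'a measure \<Rightarrow> bool" where
  "optimal_solution_pair X \<mu> \<Lambda> \<nu> \<psi> \<longleftrightarrow>
     (\<nu>, \<psi>) \<in> feasible_pairs X \<mu> \<Lambda> \<and> emeasure \<nu> X = optimal_value_pairs X \<mu> \<Lambda>"

end

theory Submission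
  imports Defs
begin

text \<open>Let \<open>N\<close> be a \<open>\<Lambda>\<close>-null set of maximal \<open>\<mu>\<close>-measure, which exists because null sets are closed
  under countable unions. The restriction \<open>\<nu>\<^sub>0\<close> of \<open>\<mu>\<close> to the complement of \<open>N\<close> is absolutely
  continuous, as a \<open>\<Lambda>\<close>-null set of positive \<open>\<nu>\<^sub>0\<close>-measure could be adjoined to \<open>N\<close>. Every feasible
  \<open>\<nu>\<close> kills \<open>N\<close>, so \<open>\<nu> \<le> \<nu>\<^sub>0\<close>: the problem has a greatest feasible point, not merely one of greatest
  mass. If \<open>\<mu> = \<nu> + \<psi>\<close> is a Lebesgue decomposition with \<open>\<psi>\<close> vanishing on \<open>A\<close> and \<open>\<Lambda>\<close> on its
  complement, then \<open>\<nu>(X) = \<nu>(A) = \<mu>(A) \<ge> \<nu>\<^sub>0(A) = \<nu>\<^sub>0(X)\<close>, so \<open>\<nu>\<close> is optimal as well.\<close>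

lemma ex_null_set_max_emeasure:
  assumes "sets L \<subseteq> sets M"
  obtains N where "N \<in> null_sets L"
    and "\<And>B. B \<in> null_sets L \<Longrightarrow> emeasure M B \<le> emeasure M N"
proof -
  have "null_sets L \<noteq> {}" by auto
  \<comment> \<open>The supremum over all null sets is already the supremum of a sequence of their
    measures. The union of the corresponding sets is again null and dominates every term, so it
    attains the supremum.\<close>
  from ennreal_SUP_countable_SUP[OF this, of "emeasure M"] obtain f :: "nat \<Rightarrow> ennreal"
    where f: "range f \<subseteq> emeasure M ` null_sets L"
      and sup: "(SUP B\<in>null_sets L. emeasure M B) = (SUP i. f i)" by metis
  from f have "\<forall>i. \<exists>B\<in>null_sets L. f i = emeasure M B" by auto
  then obtain S where S: "\<And>i. S i \<in> null_sets L" "\<And>i. f i = emeasure M (S i)" by metis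
  have N: "(\<Union>i. S i) \<in> null_sets L" using S by auto
  have "f i \<le> emeasure M (\<Union>i. S i)" for i
    unfolding S(2) using N assms by (intro emeasure_mono) auto
  then have "emeasure M B \<le> emeasure M (\<Union>i. S i)" if "B \<in> null_sets L" for B
    using SUP_upper[OF that, of "emeasure M"] unfolding sup by (meson SUP_least order_trans)
  with N show thesis by (rule that)
qed

lemma absolutely_continuous_restrict_off_null_set:
  assumes "finite_measure M" and sets: "sets L = sets M" and N: "N \<in> null_sets L"
    and max: "\<And>B. B \<in> null_sets L \<Longrightarrow> emeasure M B \<le> emeasure M N"
  shows "absolutely_continuous L (density M (indicator (space M - N)))"
  unfolding absolutely_continuous_def
proof
  interpret finite_measure M by fact
  have [measurable]: "N \<in> sets M" using N sets by auto
  fix B assume B: "B \<in> null_sets L"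
  then have [measurable]: "B \<in> sets M" using sets by auto
  \<comment> \<open>Maximality of \<open>N\<close> is tested on the null set
    \<open>N \<union> B\<close>. As \<open>emeasure M N\<close> is finite it cancels, leaving
    measure zero for \<open>B - N\<close>, the part of \<open>B\<close> that the restriction
    sees.\<close>
  have "emeasure M N + emeasure M (B - N) = emeasure M (N \<union> B)"
    by (subst plus_emeasure) auto
  also have "\<dots> \<le> emeasure M N + 0" using max B N by auto
  finally have "emeasure M (B - N) = 0"
    by (simp add: ennreal_add_left_cancel_le)
  moreover have "(space M - N) \<inter> B = B - N"
    using sets.sets_into_space[of B M] by auto
  ultimately show "B \<in> null_sets (density M (indicator (space M - N)))"
    by (auto simp: null_sets_def emeasure_restricted)
qed

text \<open>By absolute continuity \<open>N\<close> is also \<open>K\<close>-null, so removing it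
  from \<open>B\<close> costs \<open>K\<close> nothing, and off \<open>N\<close> the restricted
  measure is \<open>M\<close> itself.\<close>

lemma emeasure_le_restrict_off_null_set:
  assumes sets: "sets L = sets M" "sets K = sets M" and N: "N \<in> null_sets L"
    and le: "\<And>B. B \<in> sets M \<Longrightarrow> emeasure K B \<le> emeasure M B"
    and ac: "absolutely_continuous L K" and B: "B \<in> sets M"
  shows "emeasure K B \<le> emeasure (density M (indicator (space M - N))) B"
proof -
  have NK: "N \<in> null_sets K" using ac N by (auto simp: absolutely_continuous_def)
  have NM: "N \<in> sets M" using N sets by auto
  have "emeasure K B = emeasure K (B - N)"
    using emeasure_Diff_null_set[OF NK, of B] B sets by simp
  also have "\<dots> \<le> emeasure M (B - N)" using le B NM by auto
  also have "B - N = (space M - N) \<inter> B" using sets.sets_into_space[OF B] by auto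
  finally show ?thesis using B NM by (simp add: emeasure_restricted)
qed

text \<open>A deficit of \<open>K\<close> on some set would have to be made up on its complement,
  which setwise domination forbids. This turns a comparison of total masses into equality of
  measures.\<close>

lemma measure_eqI_le_space:
  assumes fin: "finite_measure K" and sets: "sets K = sets M"
    and le: "\<And>B. B \<in> sets M \<Longrightarrow> emeasure K B \<le> emeasure M B"
    and sp: "emeasure M (space M) \<le> emeasure K (space M)"
  shows "K = M"
proof (rule measure_eqI[OF sets])
  interpret finite_measure K by fact
  have space: "space K = space M" using sets by (rule sets_eq_imp_space_eq)
  fix B assume "B \<in> sets K"
  then have B: "B \<in> sets M" using sets by simp
  have "emeasure M B + emeasure M (space M - B) = emeasure M (space M)"
    using B sets.sets_into_space[OF B] by (subst plus_emeasure) (auto simp: Un_absorb1)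
  also have "\<dots> \<le> emeasure K (space M)" by (rule sp)
  also have "\<dots> = emeasure K B + emeasure K (space M - B)"
    using B sets sets.sets_into_space[OF B] by (subst plus_emeasure) (auto simp: Un_absorb1)
  also have "\<dots> \<le> emeasure K B + emeasure M (space M - B)"
    using le B by (intro add_left_mono) auto
  finally have le1: "emeasure M B + emeasure M (space M - B) \<le> emeasure K B + emeasure M (space M - B)" .
  \<comment> \<open>\<open>M\<close> inherits finiteness from \<open>K\<close> through the mass
    inequality; this permits cancelling the mass of the complement in \<open>le1\<close>.\<close>
  have "emeasure M (space M) \<noteq> \<infinity>" using sp space finite_emeasure_space by (auto simp: top_unique)
  then have "emeasure M (space M - B) \<noteq> \<infinity>"
    using emeasure_space[of M "space M - B"] by (auto simp: top_unique)
  with le1 have "emeasure M B \<le> emeasure K B"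
    by (simp add: ennreal_add_left_cancel_le add.commute)
  with le[OF B] show "emeasure K B = emeasure M B" by simp
qed

lemma is_measure_sum_diff_measure:
  assumes "finite_measure \<mu>" "finite_measure \<nu>" "sets \<nu> = sets \<mu>"
    and le: "\<And>B. B \<in> sets \<mu> \<Longrightarrow> emeasure \<nu> B \<le> emeasure \<mu> B"
  shows "is_measure_sum \<mu> \<nu> (diff_measure \<mu> \<nu>)"
  using assms
  by (simp add: is_measure_sum_def emeasure_diff_measure ennreal_add_diff_cancel add_diff_eq_ennreal
      finite_measure.emeasure_eq_measure)

lemma is_measure_sum_eq_diff_measure:
  assumes fin: "finite_measure \<mu>" "finite_measure \<nu>" and sum: "is_measure_sum \<mu> \<nu> \<psi>"
  shows "\<psi> = diff_measure \<mu> \<nu>"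
proof (rule measure_eqI)
  show "sets \<psi> = sets (diff_measure \<mu> \<nu>)" using sum by (simp add: is_measure_sum_def)
  fix B assume "B \<in> sets \<psi>"
  then have B: "B \<in> sets \<mu>" and add: "\<And>B. B \<in> sets \<mu> \<Longrightarrow> emeasure \<mu> B = emeasure \<nu> B + emeasure \<psi> B"
    using sum by (simp_all add: is_measure_sum_def)
  have "emeasure (diff_measure \<mu> \<nu>) B = emeasure \<mu> B - emeasure \<nu> B"
    using fin sum B add by (intro emeasure_diff_measure) (auto simp: is_measure_sum_def)
  \<comment> \<open>Subtraction in \<open>ennreal\<close> undoes addition here because
    \<open>emeasure \<nu> B\<close> is finite.\<close>
  also have "\<dots> = emeasure \<psi> B"
    using add[OF B] fin(2) by (simp add: finite_measure.emeasure_eq_measure)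
  finally show "emeasure \<psi> B = emeasure (diff_measure \<mu> \<nu>) B" by simp
qed

lemma finite_measure_diff_measure:
  assumes "finite_measure \<mu>" "finite_measure \<nu>" "sets \<nu> = sets \<mu>"
    and "\<And>B. B \<in> sets \<mu> \<Longrightarrow> emeasure \<nu> B \<le> emeasure \<mu> B"
  shows "finite_measure (diff_measure \<mu> \<nu>)"
  using assms
  by (intro finite_measureI) (simp add: emeasure_diff_measure finite_measure.emeasure_eq_measure)

text \<open>Links the two forms of the problem: the sum constraint forces the slack to be the
  difference and implies domination by \<mu>; conversely, domination makes the difference a finite
  measure that restores the sum.\<close>

lemma feasible_pairs_iff:
  assumes \<mu>: "\<mu> \<in> fin_borel_measures X"
  shows "(\<nu>, \<psi>) \<in> feasible_pairs X \<mu> \<Lambda> \<longleftrightarrow> \<nu> \<in> feasible X \<mu> \<Lambda> \<and> \<psi> = diff_measure \<mu> \<nu>"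
proof
  assume "(\<nu>, \<psi>) \<in> feasible_pairs X \<mu> \<Lambda>"
  then show "\<nu> \<in> feasible X \<mu> \<Lambda> \<and> \<psi> = diff_measure \<mu> \<nu>"
    using \<mu> by (auto simp: feasible_pairs_def feasible_def ac_cone_def fin_borel_measures_def
        is_measure_sum_eq_diff_measure is_measure_sum_def) (metis le_iff_add)
next
  assume "\<nu> \<in> feasible X \<mu> \<Lambda> \<and> \<psi> = diff_measure \<mu> \<nu>"
  then show "(\<nu>, \<psi>) \<in> feasible_pairs X \<mu> \<Lambda>"
    using \<mu> by (auto simp: feasible_pairs_def feasible_def ac_cone_def fin_borel_measures_def
        intro!: is_measure_sum_diff_measure finite_measure_diff_measure)
qed

text \<open>The feasible pairs form the graph of \<open>diff_measure \<mu>\<close> over the feasible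
  set, and the objective reads only the first component.\<close>

lemma optimal_value_pairs_eq:
  assumes "\<mu> \<in> fin_borel_measures X"
  shows "optimal_value_pairs X \<mu> \<Lambda> = optimal_value X \<mu> \<Lambda>"
proof -
  have "feasible_pairs X \<mu> \<Lambda> = (\<lambda>\<nu>. (\<nu>, diff_measure \<mu> \<nu>)) ` feasible X \<mu> \<Lambda>"
    using feasible_pairs_iff[OF assms] by auto
  then show ?thesis
    by (simp add: optimal_value_pairs_def optimal_value_def image_image)
qed

text \<open>Singularity aside, a Lebesgue decomposition is exactly a feasible pair.\<close>

lemma feasible_of_lebesgue_decomposition:
  assumes "\<mu> \<in> fin_borel_measures X" "lebesgue_decomposition X \<mu> \<Lambda> \<nu> \<psi>"
  shows "\<nu> \<in> feasible X \<mu> \<Lambda> \<and> \<psi> = diff_measure \<mu> \<nu>"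
  using assms
  by (simp add: feasible_pairs_iff[symmetric])
     (simp add: feasible_pairs_def ac_cone_def lebesgue_decomposition_def)

lemma lebesgue_decomposition_le:
  assumes decomp: "lebesgue_decomposition X \<mu> \<Lambda> \<nu> \<psi>" and sets: "sets \<Lambda> = sets \<mu>"
    and \<kappa>: "\<kappa> \<in> feasible X \<mu> \<Lambda>"
  shows "emeasure \<kappa> (space \<mu>) \<le> emeasure \<nu> (space \<mu>)"
proof -
  have space: "space \<Lambda> = space \<mu>" using sets by (rule sets_eq_imp_space_eq)
  obtain A where A: "A \<in> sets \<mu>" "emeasure \<psi> A = 0" "emeasure \<Lambda> (space \<mu> - A) = 0"
    using decomp sets space by (auto simp: lebesgue_decomposition_def mutually_singular_def)
  have add: "emeasure \<nu> A + emeasure \<psi> A = emeasure \<mu> A" and s\<nu>: "sets \<nu> = sets \<mu>"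
    using decomp A by (auto simp: lebesgue_decomposition_def is_measure_sum_def)
  have s\<kappa>: "sets \<kappa> = sets \<mu>"
    using \<kappa> decomp s\<nu> by (auto simp: feasible_def lebesgue_decomposition_def fin_borel_measures_def)
  have "space \<mu> - A \<in> null_sets \<Lambda>" using A sets by auto
  then have null: "space \<mu> - A \<in> null_sets \<kappa>"
    using \<kappa> by (auto simp: feasible_def absolutely_continuous_def)
  \<comment> \<open>All mass of \<kappa> sits on \<open>A\<close>, where \<psi> vanishes and hence
    \<mu> and \<nu> agree.\<close>
  have "emeasure \<kappa> (space \<mu>) = emeasure \<kappa> (space \<mu> - (space \<mu> - A))"
    using emeasure_Diff_null_set[OF null, of "space \<mu>"] s\<kappa> by simp
  also have "space \<mu> - (space \<mu> - A) = A" using sets.sets_into_space[OF A(1)] by auto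
  also have "emeasure \<kappa> A \<le> emeasure \<mu> A" using \<kappa> A by (auto simp: feasible_def)
  also have "\<dots> = emeasure \<nu> A" using add A by simp
  also have "\<dots> \<le> emeasure \<nu> (space \<mu>)"
    using s\<nu> sets.sets_into_space[OF A(1)] by (intro emeasure_mono) auto
  finally show ?thesis .
qed

lemma ex_greatest_feasible:
  assumes \<mu>: "\<mu> \<in> fin_borel_measures X" and \<Lambda>: "\<Lambda> \<in> fin_borel_measures X"
  obtains \<nu>\<^sub>0 where "\<nu>\<^sub>0 \<in> feasible X \<mu> \<Lambda>"
    and "\<And>\<nu> B. \<nu> \<in> feasible X \<mu> \<Lambda> \<Longrightarrow> B \<in> sets \<mu> \<Longrightarrow> emeasure \<nu> B \<le> emeasure \<nu>\<^sub>0 B"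
    and "mutually_singular (diff_measure \<mu> \<nu>\<^sub>0) \<Lambda>"
proof -
  have fin: "finite_measure \<mu>" and sets: "sets \<Lambda> = sets \<mu>"
    using \<mu> \<Lambda> by (simp_all add: fin_borel_measures_def)
  interpret finite_measure \<mu> by (rule fin)
  have space: "space \<Lambda> = space \<mu>" using sets by (rule sets_eq_imp_space_eq)
  obtain N where N: "N \<in> null_sets \<Lambda>"
    and max: "\<And>B. B \<in> null_sets \<Lambda> \<Longrightarrow> emeasure \<mu> B \<le> emeasure \<mu> N"
    by (rule ex_null_set_max_emeasure[of \<Lambda> \<mu>]) (auto simp: sets)
  have NM: "N \<in> sets \<mu>" using N sets by auto
  define \<nu>\<^sub>0 where "\<nu>\<^sub>0 = density \<mu> (indicator (space \<mu> - N))"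
  have em: "emeasure \<nu>\<^sub>0 B = emeasure \<mu> ((space \<mu> - N) \<inter> B)" if "B \<in> sets \<mu>" for B
    using that NM by (simp add: \<nu>\<^sub>0_def emeasure_restricted)
  have s0: "sets \<nu>\<^sub>0 = sets \<mu>" by (simp add: \<nu>\<^sub>0_def)
  have le0: "emeasure \<nu>\<^sub>0 B \<le> emeasure \<mu> B" if "B \<in> sets \<mu>" for B
    using that by (auto simp: em intro: emeasure_mono)
  have fin0: "finite_measure \<nu>\<^sub>0"
    using NM unfolding \<nu>\<^sub>0_def by (intro finite_measure_restricted) auto
  have ac0: "absolutely_continuous \<Lambda> \<nu>\<^sub>0"
    unfolding \<nu>\<^sub>0_def using fin sets N max by (rule absolutely_continuous_restrict_off_null_set)
  show thesis
  proof
    show "\<nu>\<^sub>0 \<in> feasible X \<mu> \<Lambda>"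
      using \<mu> s0 le0 fin0 ac0 by (simp add: feasible_def fin_borel_measures_def)
    show "emeasure \<nu> B \<le> emeasure \<nu>\<^sub>0 B" if "\<nu> \<in> feasible X \<mu> \<Lambda>" "B \<in> sets \<mu>" for \<nu> B
      unfolding \<nu>\<^sub>0_def using that sets N \<mu>
      by (intro emeasure_le_restrict_off_null_set) (auto simp: feasible_def fin_borel_measures_def)
    \<comment> \<open>The complement of \<open>N\<close> witnesses singularity:
      \<open>\<nu>\<^sub>0\<close> and \<mu> coincide there, so their difference vanishes, while
      \<Lambda> vanishes on \<open>N\<close>.\<close>
    have "(space \<mu> - N) \<inter> (space \<mu> - N) = space \<mu> - N" by simp
    then have "emeasure (diff_measure \<mu> \<nu>\<^sub>0) (space \<mu> - N) = 0"
      using emeasure_diff_measure[OF fin fin0 s0[symmetric] le0, of "space \<mu> - N"] NM em[of "space \<mu> - N"]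
      by simp
    moreover have "space \<mu> - (space \<mu> - N) = N" using sets.sets_into_space[OF NM] by auto
    ultimately show "mutually_singular (diff_measure \<mu> \<nu>\<^sub>0) \<Lambda>"
      using N NM sets space by (auto simp: mutually_singular_def intro!: bexI[of _ "space \<mu> - N"])
  qed
qed

theorem theorem2p1:
  fixes X :: "(real ^ 'n) set" and \<mu> \<Lambda> :: "(real ^ 'n) measure"
  assumes "X \<in> sets borel"
    and "\<mu> \<in> fin_borel_measures X" and "\<Lambda> \<in> fin_borel_measures X"
  shows "optimal_value X \<mu> \<Lambda> = optimal_value_pairs X \<mu> \<Lambda> \<and>
    (\<exists>\<nu>s \<in> fin_borel_measures X.
       (\<forall>\<nu>. optimal_solution X \<mu> \<Lambda> \<nu> \<longleftrightarrow> \<nu> = \<nu>s) \<and>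
       (\<forall>\<nu> \<psi>. optimal_solution_pair X \<mu> \<Lambda> \<nu> \<psi> \<longleftrightarrow> \<nu> = \<nu>s \<and> \<psi> = diff_measure \<mu> \<nu>s) \<and>
       lebesgue_decomposition X \<mu> \<Lambda> \<nu>s (diff_measure \<mu> \<nu>s) \<and>
       (\<forall>\<nu> \<psi>. lebesgue_decomposition X \<mu> \<Lambda> \<nu> \<psi> \<longrightarrow> \<nu> = \<nu>s \<and> \<psi> = diff_measure \<mu> \<nu>s))"
proof -
  note \<mu> = assms(2) and \<Lambda> = assms(3)
  have fin: "finite_measure \<mu>" and sets: "sets \<Lambda> = sets \<mu>" and X: "space \<mu> = X"
    using \<mu> \<Lambda> sets_eq_imp_space_eq[of \<mu> "restrict_space borel X"]
    by (auto simp: fin_borel_measures_def space_restrict_space)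
  obtain \<nu>\<^sub>0 where feas: "\<nu>\<^sub>0 \<in> feasible X \<mu> \<Lambda>"
    and ge: "\<And>\<nu> B. \<nu> \<in> feasible X \<mu> \<Lambda> \<Longrightarrow> B \<in> sets \<mu> \<Longrightarrow> emeasure \<nu> B \<le> emeasure \<nu>\<^sub>0 B"
    and sing: "mutually_singular (diff_measure \<mu> \<nu>\<^sub>0) \<Lambda>"
    using ex_greatest_feasible[OF \<mu> \<Lambda>] by blast
  have X_in: "X \<in> sets \<mu>" using X sets.top[of \<mu>] by simp
  have optimal: "optimal_value X \<mu> \<Lambda> = emeasure \<nu>\<^sub>0 X"
    unfolding optimal_value_def
    using feas ge X_in by (intro antisym SUP_least SUP_upper) auto
  \<comment> \<open>Stated with a mass inequality instead of optimality, so that it serves both for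
    optimal solutions and for arbitrary Lebesgue decompositions.\<close>
  have unique: "\<nu> = \<nu>\<^sub>0" if \<nu>: "\<nu> \<in> feasible X \<mu> \<Lambda>" and "emeasure \<nu>\<^sub>0 X \<le> emeasure \<nu> X" for \<nu>
  proof (rule measure_eqI_le_space)
    have "sets \<nu>\<^sub>0 = sets \<mu>" using feas \<mu> by (simp add: feasible_def fin_borel_measures_def)
    moreover from this have "space \<nu>\<^sub>0 = X" using X sets_eq_imp_space_eq by blast
    ultimately show "\<And>B. B \<in> sets \<nu>\<^sub>0 \<Longrightarrow> emeasure \<nu> B \<le> emeasure \<nu>\<^sub>0 B"
      and "emeasure \<nu>\<^sub>0 (space \<nu>\<^sub>0) \<le> emeasure \<nu> (space \<nu>\<^sub>0)"
      using ge \<nu> that(2) by auto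
    show "finite_measure \<nu>" "sets \<nu> = sets \<nu>\<^sub>0"
      using \<nu> feas by (simp_all add: feasible_def fin_borel_measures_def)
  qed
  have solution: "optimal_solution X \<mu> \<Lambda> \<nu> \<longleftrightarrow> \<nu> = \<nu>\<^sub>0" for \<nu>
    unfolding optimal_solution_def optimal using unique[of \<nu>] feas by (metis order_refl)
  have pair: "optimal_solution_pair X \<mu> \<Lambda> \<nu> \<psi> \<longleftrightarrow> \<nu> = \<nu>\<^sub>0 \<and> \<psi> = diff_measure \<mu> \<nu>\<^sub>0" for \<nu> \<psi>
    using solution[of \<nu>] \<mu>
    by (auto simp: optimal_solution_pair_def optimal_solution_def optimal_value_pairs_eq
        feasible_pairs_iff)
  have "(\<nu>\<^sub>0, diff_measure \<mu> \<nu>\<^sub>0) \<in> feasible_pairs X \<mu> \<Lambda>"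
    using feas \<mu> by (simp add: feasible_pairs_iff)
  then have decomp: "lebesgue_decomposition X \<mu> \<Lambda> \<nu>\<^sub>0 (diff_measure \<mu> \<nu>\<^sub>0)"
    using sing by (simp add: feasible_pairs_def ac_cone_def lebesgue_decomposition_def)
  \<comment> \<open>The first component is feasible and, by \<open>lebesgue_decomposition_le\<close>
    with \<open>\<nu>\<^sub>0\<close> as competitor, has at least the mass of
    \<open>\<nu>\<^sub>0\<close>; thus \<open>unique\<close> applies.\<close>
  have "\<nu> = \<nu>\<^sub>0 \<and> \<psi> = diff_measure \<mu> \<nu>\<^sub>0" if "lebesgue_decomposition X \<mu> \<Lambda> \<nu> \<psi>" for \<nu> \<psi>
    using feasible_of_lebesgue_decomposition[OF \<mu> that] unique[of \<nu>]
      lebesgue_decomposition_le[OF that sets feas] X by auto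
  moreover have "\<nu>\<^sub>0 \<in> fin_borel_measures X" using feas by (simp add: feasible_def)
  ultimately show ?thesis
    using solution pair decomp optimal_value_pairs_eq[OF \<mu>, of \<Lambda>] by metis
qed

end
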